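(* Let $K$ be an even integer and let $m>1$ be an integer with $4\nmid m$. Then: (1) if $m>3$, then $\omega_K(m)=4$ if and only if $\alpha_K(m)\equiv\pm1\pmod 4$; (2) $\omega_K(m)=2$ if and only if $4\mid\pi_K(m)$ and $2\mid\alpha_K(m)$; (3) $\omega_K(m)=1$ if and only if $4\nmid\pi_K(m)$.
   Context: For an integer $K$, the $K$-Fibonacci sequence is $F_{K,0}=0$, $F_{K,1}=1$, $F_{K,n}=KF_{K,n-1}+F_{K,n-2}$ for $n\ge2$. For an integer $m\ge 2$, $\pi_K(m)$ is the least positive period of $(F_{K,n}\bmod m)$, $\alpha_K(m)$ is the least positive index $n$ with $m\mid F_{K,n}$, and $\omega_K(m)$ is the number of indices $0\le n<\pi_K(m)$ with $m\mid F_{K,n}$. *)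

theory Defs
  imports "HOL-Number_Theory.Number_Theory"
begin

fun kfib :: "int \<Rightarrow> nat \<Rightarrow> int" where
  "kfib K 0 = 0"
| "kfib K (Suc 0) = 1"
| "kfib K (Suc (Suc n)) = K * kfib K (Suc n) + kfib K n"

text \<open>
  The recurrence is invertible modulo every \<open>m\<close>, so for \<open>m > 1\<close> the reduced sequence is purely
  periodic. Hence periods are required to hold from index \<open>0\<close> on, and both \<open>LEAST\<close>s below range over
  nonempty sets.
\<close>

definition pisano_period :: "int \<Rightarrow> int \<Rightarrow> nat" where
  "pisano_period K m = (LEAST p. p > 0 \<and> (\<forall>n. [kfib K (n + p) = kfib K n] (mod m)))"

definition rank_of_apparition :: "int \<Rightarrow> int \<Rightarrow> nat" where
  "rank_of_apparition K m = (LEAST n. n > 0 \<and> m dvd kfib K n)"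

definition zeros_per_period :: "int \<Rightarrow> int \<Rightarrow> nat" where
  "zeros_per_period K m = card {n. n < pisano_period K m \<and> m dvd kfib K n}"

end

theory Submission
  imports Defs
begin

text \<open>
  Let \<open>a\<close> be the rank of apparition and \<open>\<lambda> = kfib K (a + 1)\<close>. Shifting the sequence by \<open>a\<close>
  multiplies it by \<open>\<lambda>\<close> modulo \<open>m\<close>, so the zeros are the multiples of \<open>a\<close> and the number of zeros
  per period is the multiplicative order of \<open>\<lambda>\<close>. Cassini's identity gives \<open>\<lambda>\<^sup>2 \<equiv> (-1)\<^sup>a\<close>, so this
  order is 4 for odd \<open>a\<close> and 1 or 2 for even \<open>a\<close>. It remains to see that \<open>\<lambda> \<equiv> 1\<close> is impossible
  when \<open>a = 2n\<close> with \<open>n\<close> even: the doubling formulas then give \<open>m dvd 2 * kfib K n\<close>, and as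
  \<open>kfib K n\<close> is even and \<open>4\<close> does not divide \<open>m\<close>, already \<open>m dvd kfib K n\<close>, contradicting the
  minimality of \<open>a\<close>.
\<close>

section \<open>Algebraic identities and pure periodicity modulo \<open>m\<close>\<close>

lemma kfib_add:
  "kfib K (n + k) = kfib K (k + 1) * kfib K n + kfib K k * (kfib K (n + 1) - K * kfib K n)"
  by (induction K n rule: kfib.induct) (simp_all add: algebra_simps)

text \<open>The term \<open>kfib K (n + 1) - K * kfib K n\<close>, also present in
  \<open>kfib_add\<close>, stands for the entry at index \<open>n - 1\<close>. This form stays valid
  at \<open>n = 0\<close>, where the entry at index -1 is 1.\<close>

lemma kfib_cassini:
  "kfib K (n + 1) ^ 2 - K * kfib K n * kfib K (n + 1) - kfib K n ^ 2 = (- 1) ^ n"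
proof (induction n)
  case (Suc n)
  have "kfib K (Suc n + 1) ^ 2 - K * kfib K (Suc n) * kfib K (Suc n + 1) - kfib K (Suc n) ^ 2
      = - (kfib K (n + 1) ^ 2 - K * kfib K n * kfib K (n + 1) - kfib K n ^ 2)"
    by (simp add: algebra_simps power2_eq_square)
  then show ?case using Suc by simp
qed simp

lemma even_kfib:
  assumes "even K" and "even n"
  shows "even (kfib K n)"
  using assms by (induction K n rule: kfib.induct) auto

text \<open>The recurrence runs backwards without division, so agreement on a pair of consecutive
  entries can be pulled back to index 0.\<close>

lemma kfib_cong_shift_down:
  assumes "[kfib K (i + p) = kfib K i] (mod m)" and "[kfib K (i + p + 1) = kfib K (i + 1)] (mod m)"
  shows "[kfib K p = 0] (mod m) \<and> [kfib K (p + 1) = 1] (mod m)"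
  using assms
proof (induction i)
  case (Suc i)
  have "[kfib K (i + p + 2) - K * kfib K (i + p + 1) = kfib K (i + 2) - K * kfib K (i + 1)] (mod m)"
    using Suc.prems by (intro cong_diff cong_mult cong_refl) (simp_all add: numeral_2_eq_2)
  then have "[kfib K (i + p) = kfib K i] (mod m)"
    by (simp add: numeral_2_eq_2)
  moreover have "[kfib K (i + p + 1) = kfib K (i + 1)] (mod m)"
    using Suc.prems by simp
  ultimately show ?case by (rule Suc.IH)
qed simp

text \<open>Pigeonhole: there are only finitely many pairs of consecutive residues, so some pair
  repeats and can be moved back to the start.\<close>

lemma kfib_period_exists:
  fixes m :: int
  assumes "m > 0"
  shows "\<exists>p>0. [kfib K p = 0] (mod m) \<and> [kfib K (p + 1) = 1] (mod m)"
proof -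
  define f where "f n = (kfib K n mod m, kfib K (n + 1) mod m)" for n
  have "range f \<subseteq> {0..<m} \<times> {0..<m}"
    using assms by (auto simp: f_def)
  then have "finite (range f)"
    by (rule finite_subset) simp
  then have "\<not> inj f"
    using finite_imageD by blast
  then obtain i j where ij: "f i = f j" "i < j"
    unfolding inj_def by (metis linorder_neqE_nat)
  then obtain p where p: "j = i + p" "p > 0"
    using less_imp_add_positive by blast
  show ?thesis
    using kfib_cong_shift_down[of K i p m] ij p by (auto simp: f_def cong_def)
qed

section \<open>Zeros modulo \<open>m\<close> and the rank of apparition\<close>

lemma
  assumes "(m::int) > 0"
  shows rank_of_apparition_pos: "rank_of_apparition K m > 0"
    and rank_of_apparition_dvd: "m dvd kfib K (rank_of_apparition K m)"
proof -
  obtain p where "p > 0 \<and> m dvd kfib K p"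
    using kfib_period_exists[OF assms] by (auto simp: cong_0_iff)
  then have "rank_of_apparition K m > 0 \<and> m dvd kfib K (rank_of_apparition K m)"
    unfolding rank_of_apparition_def by (rule LeastI)
  then show "rank_of_apparition K m > 0" and "m dvd kfib K (rank_of_apparition K m)"
    by auto
qed

lemma rank_of_apparition_le:
  "n > 0 \<Longrightarrow> m dvd kfib K n \<Longrightarrow> rank_of_apparition K m \<le> n"
  unfolding rank_of_apparition_def by (rule Least_le) simp

lemma kfib_add_mult_cong:
  assumes "m dvd kfib K a"
  shows "[kfib K (n + k * a) = kfib K (a + 1) ^ k * kfib K n] (mod m)"
proof (induction k)
  case (Suc k)
  have "[kfib K ((n + k * a) + a) = kfib K (a + 1) * kfib K (n + k * a)] (mod m)"
    using assms unfolding kfib_add[of K "n + k * a" a] by (simp add: cong_iff_dvd_diff)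
  also have "[kfib K (a + 1) * kfib K (n + k * a)
      = kfib K (a + 1) * (kfib K (a + 1) ^ k * kfib K n)] (mod m)"
    using Suc by (intro cong_mult cong_refl)
  finally show ?case by (simp add: algebra_simps)
qed simp

lemma kfib_Suc_square_cong:
  assumes "m dvd kfib K a"
  shows "[kfib K (a + 1) ^ 2 = (- 1) ^ a] (mod m)"
proof -
  have "kfib K (a + 1) ^ 2 - (- 1) ^ a = kfib K a * (K * kfib K (a + 1) + kfib K a)"
    using kfib_cassini[of K a] by (simp add: algebra_simps power2_eq_square)
  then show ?thesis
    using assms by (metis cong_iff_dvd_diff dvd_mult2)
qed

text \<open>The square of the multiplier is congruent to 1 or -1, hence a unit.\<close>

lemma coprime_kfib_Suc:
  assumes "m dvd kfib K a"
  shows "coprime (kfib K (a + 1)) m"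
proof -
  have "coprime ((- 1) ^ a) m"
    by (cases "even a") simp_all
  then have "coprime (kfib K (a + 1) ^ 2) m"
    using kfib_Suc_square_cong[OF assms] cong_imp_coprime cong_sym by blast
  then show ?thesis by simp
qed

lemma dvd_kfib_iff:
  assumes "(m::int) > 0"
  shows "m dvd kfib K n \<longleftrightarrow> rank_of_apparition K m dvd n"
proof -
  define a where "a = rank_of_apparition K m"
  have a: "a > 0" "m dvd kfib K a"
    using assms rank_of_apparition_pos rank_of_apparition_dvd by (auto simp: a_def)
  have cop: "coprime m (kfib K (a + 1) ^ (n div a))"
    using coprime_kfib_Suc[OF a(2)] by (simp add: coprime_commute)
  have "[kfib K n = kfib K (a + 1) ^ (n div a) * kfib K (n mod a)] (mod m)"
    using kfib_add_mult_cong[OF a(2), of "n mod a" "n div a"] by simp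
  then have "m dvd kfib K n \<longleftrightarrow> m dvd kfib K (a + 1) ^ (n div a) * kfib K (n mod a)"
    by (rule cong_dvd_iff)
  also have "\<dots> \<longleftrightarrow> m dvd kfib K (n mod a)"
    using coprime_dvd_mult_right_iff[OF cop] .
  also have "\<dots> \<longleftrightarrow> n mod a = 0"
    using rank_of_apparition_le[of "n mod a" m K] a(1)
    by (metis a_def bot_nat_0.not_eq_extremum dvd_0_right kfib.simps(1) leD mod_less_divisor)
  finally show ?thesis
    by (simp add: a_def mod_eq_0_iff_dvd)
qed

text \<open>A period sends the zero at index 0 to a zero, so it is a multiple of \<open>a\<close>;
  comparing at index 1, where the sequence is 1, isolates the power of the multiplier.\<close>

lemma kfib_period_iff:
  fixes K m :: int
  assumes "m > 0"
  defines "a \<equiv> rank_of_apparition K m"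
  shows "(\<forall>n. [kfib K (n + p) = kfib K n] (mod m)) \<longleftrightarrow>
    (\<exists>k. p = k * a \<and> [kfib K (a + 1) ^ k = 1] (mod m))"
proof -
  have dvd: "m dvd kfib K a"
    unfolding a_def by (rule rank_of_apparition_dvd[OF assms(1)])
  show ?thesis
  proof
    assume *: "\<forall>n. [kfib K (n + p) = kfib K n] (mod m)"
    have "m dvd kfib K p"
      using *[rule_format, of 0] by (simp add: cong_0_iff)
    then obtain k where k: "p = k * a"
      unfolding dvd_kfib_iff[OF assms(1)] a_def by (metis dvdE mult.commute)
    have "[kfib K (a + 1) ^ k * kfib K 1 = kfib K (1 + p)] (mod m)"
      unfolding k by (rule cong_sym[OF kfib_add_mult_cong[OF dvd]])
    also have "[kfib K (1 + p) = kfib K 1] (mod m)"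
      using * by blast
    finally show "\<exists>k. p = k * a \<and> [kfib K (a + 1) ^ k = 1] (mod m)"
      using k by auto
  next
    assume "\<exists>k. p = k * a \<and> [kfib K (a + 1) ^ k = 1] (mod m)"
    then obtain k where k: "p = k * a" "[kfib K (a + 1) ^ k = 1] (mod m)"
      by blast
    show "\<forall>n. [kfib K (n + p) = kfib K n] (mod m)"
    proof
      fix n
      have "[kfib K (n + p) = kfib K (a + 1) ^ k * kfib K n] (mod m)"
        unfolding k(1) by (rule kfib_add_mult_cong[OF dvd])
      also have "[kfib K (a + 1) ^ k * kfib K n = 1 * kfib K n] (mod m)"
        using k(2) by (intro cong_mult cong_refl)
      finally show "[kfib K (n + p) = kfib K n] (mod m)" by simp
    qed
  qed
qed

section \<open>Period and zero count from the order of the multiplier\<close>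

lemma card_multiples_less:
  fixes a w :: nat
  assumes "a > 0"
  shows "card {n. n < w * a \<and> a dvd n} = w"
proof -
  have "{n. n < w * a \<and> a dvd n} = (\<lambda>k. k * a) ` {..<w}"
    using assms by (auto simp: mult.commute elim!: dvdE)
  moreover have "inj_on (\<lambda>k. k * a) {..<w}"
    using assms by (auto simp: inj_on_def)
  ultimately show ?thesis
    by (simp add: card_image)
qed

text \<open>The hypotheses say that \<open>w\<close> is the multiplicative order of the multiplier
  modulo \<open>m\<close>.\<close>

lemma
  fixes m :: int and w :: nat
  assumes "m > 0" and "w > 0"
    and "[kfib K (rank_of_apparition K m + 1) ^ w = 1] (mod m)"
    and "\<And>k. 0 < k \<Longrightarrow> k < w \<Longrightarrow> \<not> [kfib K (rank_of_apparition K m + 1) ^ k = 1] (mod m)"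
  shows pisano_period_eq: "pisano_period K m = w * rank_of_apparition K m"
    and zeros_per_period_eq: "zeros_per_period K m = w"
proof -
  note pos = rank_of_apparition_pos[OF assms(1), of K]
  show *: "pisano_period K m = w * rank_of_apparition K m"
    unfolding pisano_period_def kfib_period_iff[OF assms(1)]
  proof (rule Least_equality)
    fix p
    assume "p > 0 \<and> (\<exists>k. p = k * rank_of_apparition K m
      \<and> [kfib K (rank_of_apparition K m + 1) ^ k = 1] (mod m))"
    then show "w * rank_of_apparition K m \<le> p"
      using assms(4) by (metis mult_le_mono1 nat_0_less_mult_iff not_le_imp_less)
  qed (use assms pos in auto)
  show "zeros_per_period K m = w"
    unfolding zeros_per_period_def * dvd_kfib_iff[OF assms(1)]
    by (rule card_multiples_less[OF pos])
qed

section \<open>Ranks divisible by 4 when the multiplier is 1\<close>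

lemma dvd_two_times_kfib:
  assumes "even n" and "m dvd kfib K (2 * n)" and "[kfib K (2 * n + 1) = 1] (mod m)"
  shows "m dvd 2 * kfib K n"
proof -
  define x y where "x = kfib K n" and "y = kfib K (n + 1)"
  have cassini: "y * y = 1 + K * x * y + x * x"
    using kfib_cassini[of K n] assms(1) by (simp add: x_def y_def power2_eq_square)
  have "kfib K (2 * n) = x * (2 * y - K * x)"
    using kfib_add[of K n n] by (simp add: x_def y_def algebra_simps flip: mult_2)
  then have A: "m dvd x * (2 * y - K * x)"
    using assms(2) by simp
  have "kfib K (2 * n + 1) - 1 = y * y + x * x - 1"
    using kfib_add[of K "n + 1" n] by (simp add: x_def y_def algebra_simps flip: mult_2)
  also have "\<dots> = x * (2 * x + K * y)"
    unfolding cassini by (simp add: algebra_simps)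
  finally have B: "m dvd x * (2 * x + K * y)"
    using assms(3) by (simp add: cong_iff_dvd_diff)
  \<comment> \<open>The weights \<open>y\<close> and \<open>-x\<close> make the Cassini form appear
    as a factor; it equals 1 because \<open>n\<close> is even.\<close>
  have "y * (x * (2 * y - K * x)) - x * (x * (2 * x + K * y))
      = 2 * x * (y * y - K * x * y - x * x)"
    by (simp add: algebra_simps)
  also have "\<dots> = 2 * x"
    unfolding cassini by simp
  finally show ?thesis
    using A B by (metis dvd_diff dvd_mult x_def)
qed

text \<open>If \<open>m = 2 * c\<close>, then \<open>c\<close> is odd, so 2 and \<open>c\<close>
  divide \<open>x\<close> separately and their product does too.\<close>

lemma dvd_if_dvd_two_times:
  fixes m x :: int
  assumes "m dvd 2 * x" and "even x" and "\<not> 4 dvd m"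
  shows "m dvd x"
proof (cases "even m")
  case True
  then obtain c where c: "m = 2 * c" by blast
  with assms(3) have "odd c" by auto
  then have "coprime 2 c" by simp
  moreover have "c dvd x" using assms(1) c by simp
  ultimately show ?thesis
    using assms(2) c divides_mult by blast
next
  case False
  then show ?thesis
    using assms(1) by (simp add: coprime_dvd_mult_right_iff)
qed

lemma not_4_dvd_rank_of_apparition:
  fixes K m :: int
  assumes "even K" and "m > 0" and "\<not> 4 dvd m"
    and "[kfib K (rank_of_apparition K m + 1) = 1] (mod m)"
  shows "\<not> 4 dvd rank_of_apparition K m"
proof
  assume "4 dvd rank_of_apparition K m"
  then obtain k where "rank_of_apparition K m = 4 * k" by blast
  then obtain n where n: "rank_of_apparition K m = 2 * n" "even n"
    by (metis dvd_triv_left mult.assoc mult_2_right numeral_Bit0)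
  have "m dvd 2 * kfib K n"
    using dvd_two_times_kfib[of n m K] n assms rank_of_apparition_dvd[of m K] by simp
  then have "m dvd kfib K n"
    using dvd_if_dvd_two_times even_kfib assms n by blast
  then show False
    using rank_of_apparition_le[of n m K] rank_of_apparition_pos[OF assms(2), of K] n by simp
qed

theorem theorem4p29:
  fixes K m :: int
  assumes "even K" and "m > 1" and "\<not> 4 dvd m"
  shows "(m > 3 \<longrightarrow>
            (zeros_per_period K m = 4 \<longleftrightarrow>
              [int (rank_of_apparition K m) = 1] (mod 4) \<or>
              [int (rank_of_apparition K m) = - 1] (mod 4))) \<and>
         (zeros_per_period K m = 2 \<longleftrightarrow>
            4 dvd pisano_period K m \<and> 2 dvd rank_of_apparition K m) \<and>
         (zeros_per_period K m = 1 \<longleftrightarrow> \<not> 4 dvd pisano_period K m)"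
proof -
  define a where "a = rank_of_apparition K m"
  define l where "l = kfib K (a + 1)"
  have m: "m > 0" using assms by simp
  have sq: "[l ^ 2 = (- 1) ^ a] (mod m)"
    unfolding l_def a_def by (rule kfib_Suc_square_cong[OF rank_of_apparition_dvd[OF m]])
  have odd_iff: "[int a = 1] (mod 4) \<or> [int a = - 1] (mod 4) \<longleftrightarrow> odd a"
    unfolding cong_def by simp presburger
  note eqs = pisano_period_eq[OF m, of _ K, folded a_def, folded l_def]
    zeros_per_period_eq[OF m, of _ K, folded a_def, folded l_def]
  \<comment> \<open>The cases are those of order 1, 2 and 4, with periods \<open>a\<close>,
    \<open>2 * a\<close> and \<open>4 * a\<close>.\<close>
  consider (one) "even a" "[l = 1] (mod m)" | (two) "even a" "\<not> [l = 1] (mod m)" | (odd) "odd a"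
    by blast
  then show ?thesis
  proof cases
    case one
    have "\<not> 4 dvd a"
      using not_4_dvd_rank_of_apparition[OF assms(1) m assms(3)] one(2) by (simp add: a_def l_def)
    then show ?thesis
      using eqs[of 1] one odd_iff by (simp add: a_def)
  next
    case two
    have "\<not> [l ^ k = 1] (mod m)" if "0 < k" "k < 2" for k
      using that two by (auto simp: less_2_cases_iff)
    then have "pisano_period K m = 2 * a" "zeros_per_period K m = 2"
      using eqs[of 2] two sq by auto
    then show ?thesis
      using two odd_iff by (simp add: a_def)
  next
    case odd
    \<comment> \<open>Modulo 2 the residues 1 and -1 coincide, which would spoil order 4. Since
      \<open>kfib K 2 = K\<close> is even, the rank for 2 is 2, contrary to
      \<open>odd a\<close>.\<close>
    have "m \<noteq> 2"
    proof
      assume "m = 2"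
      then have "m dvd kfib K 2" using assms(1) by (simp add: numeral_2_eq_2)
      then have "a dvd 2"
        using dvd_kfib_iff[OF m] by (simp add: a_def)
      with odd have "a = 1"
        using two_is_prime_nat by (metis prime_nat_iff dvd_refl)
      then show False
        using rank_of_apparition_dvd[OF m, of K] \<open>m = 2\<close> by (simp add: a_def)
    qed
    have sq': "[l ^ 2 = - 1] (mod m)"
      using sq odd by simp
    have not_sq: "\<not> [l ^ 2 = 1] (mod m)"
    proof
      assume "[l ^ 2 = 1] (mod m)"
      then have "[- 1 = (1::int)] (mod m)"
        using sq' cong_trans cong_sym by blast
      then have "m dvd 2"
        by (simp add: cong_iff_dvd_diff)
      then show False
        using zdvd_imp_le[of m 2] assms(2) \<open>m \<noteq> 2\<close> by simp
    qed
    have four: "[l ^ 4 = 1] (mod m)"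
      using cong_pow[OF sq', of 2] by simp
    have "\<not> [l ^ k = 1] (mod m)" if k: "0 < k" "k < 4" for k
    proof
      assume *: "[l ^ k = 1] (mod m)"
      consider "k = 1" | "k = 2" | "k = 3"
        using k by linarith
      then have "[l ^ 2 = 1] (mod m)"
      proof cases
        case 1
        then show ?thesis using cong_pow[OF *, of 2] by simp
      next
        case 2
        then show ?thesis using * by simp
      next
        case 3
        \<comment> \<open>Squaring \<open>l ^ 3\<close> gives \<open>l ^ 6\<close>, and
          \<open>l ^ 4\<close> cancels from it to leave \<open>l ^ 2\<close>.\<close>
        have "[l ^ 4 * l ^ 2 = 1 * l ^ 2] (mod m)"
          using four by (intro cong_mult cong_refl)
        moreover have "[l ^ 4 * l ^ 2 = 1] (mod m)"
          using cong_pow[OF *, of 2] 3 by (simp flip: power_mult power_add)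
        ultimately show ?thesis
          by (metis cong_sym cong_trans mult_1)
      qed
      with not_sq show False by blast
    qed
    then have "pisano_period K m = 4 * a" "zeros_per_period K m = 4"
      using eqs[of 4] four by auto
    then show ?thesis
      using odd odd_iff by (simp add: a_def)
  qed
qed

end
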